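(* Let $(\mathcal{X},d_{\mathcal{X}})$ be a finite metric space with $d_{\mathcal{X}}\le 1$, let $\|\cdot\|$ be a norm on $\mathbb{R}^d$, and let $f:\mathcal{X}\to\mathbb{R}^d$ be $\ell$-Lipschitz, i.e. $\|f(x)-f(x')\|\le \ell\, d_{\mathcal{X}}(x,x')$ for all $x,x'\in\mathcal{X}$. Let $q_f(K)=\mathbb{E}_{x\sim\tilde K}[f(x)]$ be the associated linear query. Then $$\Delta_{\mathsf{EM}}(q_f)\le \ell .$$
   Context: A dataset $K$ is a nonempty finite multiset of elements of $\mathcal{X}$; $\mathcal{X}^*$ is the set of all datasets. $\tilde K$ is the probability distribution on $\mathcal{X}$ given by $\tilde K[x]=(\text{number of occurrences of }x\text{ in }K)/|K|$. For probability distributions $P,Q$ on $\mathcal{X}$, the earth-mover's distance is $d_{\mathsf{EM}}(P,Q)=\inf_{C}\mathbb{E}_{(x,x')\sim C}[d_{\mathcal{X}}(x,x')]$, the infimum being over all couplings $C$ of $P$ and $Q$ (joint distributions on $\mathcal{X}\times\mathcal{X}$ with marginals $P$ and $Q$). The sensitivity of $q_f$ is $$\Delta_{\mathsf{EM}}(q_f)=\sup_{K,K'\in\mathcal{X}^*}\frac{\|q_f(K)-q_f(K')\|}{d_{\mathsf{EM}}(\tilde K,\tilde K')},$$ taken over pairs with $\tilde K\ne\tilde K'$. *)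

theory Defs
  imports "HOL-Probability.Probability"
begin

text \<open>An arbitrary norm on a real vector space, in general different from the one
  that the type class provides.\<close>

definition is_norm :: "('v::real_vector \<Rightarrow> real) \<Rightarrow> bool" where
  "is_norm N \<longleftrightarrow>
     (\<forall>v. 0 \<le> N v) \<and>
     (\<forall>v. N v = 0 \<longleftrightarrow> v = 0) \<and>
     (\<forall>a v. N (a *\<^sub>R v) = \<bar>a\<bar> * N v) \<and>
     (\<forall>v w. N (v + w) \<le> N v + N w)"

definition datasets :: "'a set \<Rightarrow> 'a multiset set" where
  "datasets X = {K. K \<noteq> {#} \<and> set_mset K \<subseteq> X}"

definition couplings :: "'a pmf \<Rightarrow> 'a pmf \<Rightarrow> ('a \<times> 'a) pmf set" where
  "couplings P Q = {C. map_pmf fst C = P \<and> map_pmf snd C = Q}"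

text \<open>Meant for \<open>P\<close> and \<open>Q\<close> of finite support: then every coupling has finite support, so
  that the expectations exist, and for nonnegative \<open>d\<close> they are bounded below; the set of
  couplings is nonempty, as it contains the product.\<close>

definition em_dist :: "('a \<Rightarrow> 'a \<Rightarrow> real) \<Rightarrow> 'a pmf \<Rightarrow> 'a pmf \<Rightarrow> real" where
  "em_dist d P Q = (INF C\<in>couplings P Q. measure_pmf.expectation C (\<lambda>(x, x'). d x x'))"

definition linear_query ::
    "('a \<Rightarrow> 'v::{banach, second_countable_topology}) \<Rightarrow> 'a multiset \<Rightarrow> 'v" where
  "linear_query f K = measure_pmf.expectation (pmf_of_multiset K) f"

text \<open>The supremum and the quotient are taken in the extended reals, so a positive numerator
  over a zero distance would count as \<open>\<infinity>\<close>. If no two datasets have different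
  empirical distributions (that is, if \<open>X\<close> has at most one point), the supremum is that of
  the empty set, \<open>-\<infinity>\<close>.\<close>

definition em_sensitivity ::
    "'a set \<Rightarrow> ('a \<Rightarrow> 'a \<Rightarrow> real) \<Rightarrow> ('v::real_vector \<Rightarrow> real) \<Rightarrow> ('a multiset \<Rightarrow> 'v) \<Rightarrow> ereal" where
  "em_sensitivity X d N q =
     (SUP (K, K') \<in> {(K, K'). K \<in> datasets X \<and> K' \<in> datasets X \<and>
                              pmf_of_multiset K \<noteq> pmf_of_multiset K'}.
        ereal (N (q K - q K')) / ereal (em_dist d (pmf_of_multiset K) (pmf_of_multiset K')))"

end

theory Submission
  imports Defs
begin

text \<open>For every coupling \<open>C\<close> of \<open>P\<close> and \<open>Q\<close>, linearity of the expectation gives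
  \<open>E\<^sub>P f - E\<^sub>Q f = E\<^sub>C (f x - f x')\<close>; by Jensen's inequality for the norm and the Lipschitz
  bound its norm is at most \<open>l * E\<^sub>C d(x, x')\<close>. Then take the infimum over \<open>C\<close>.\<close>

text \<open>Induction on the triangle inequality, with homogeneity pulling each scalar out. An
  infinite index set is harmless: both sums are then 0 and \<open>N 0 = 0\<close>.\<close>

lemma is_norm_sum_le:
  assumes "is_norm N"
  shows "N (\<Sum>i\<in>A. c i *\<^sub>R v i) \<le> (\<Sum>i\<in>A. \<bar>c i\<bar> * N (v i))"
proof (induction A rule: infinite_finite_induct)
  case (insert i A)
  have "N (c i *\<^sub>R v i + (\<Sum>i\<in>A. c i *\<^sub>R v i))
        \<le> N (c i *\<^sub>R v i) + N (\<Sum>i\<in>A. c i *\<^sub>R v i)"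
    and "N (c i *\<^sub>R v i) = \<bar>c i\<bar> * N (v i)"
    using assms unfolding is_norm_def by blast+
  then show ?case
    using insert by simp
next
  case empty
  then show ?case
    using assms unfolding is_norm_def by (metis order_refl sum.empty sum.infinite)
next
  case (infinite A)
  then show ?case
    using assms unfolding is_norm_def by (metis order_refl sum.empty sum.infinite)
qed

text \<open>Finite support turns both expectations into finite sums with weights
  \<open>pmf C x\<close>. The weights are nonnegative, so the absolute values in the bound for sums
  disappear.\<close>

lemma is_norm_expectation_le:
  fixes g :: "'b \<Rightarrow> 'v::{banach, second_countable_topology}"
  assumes "is_norm N" and "finite (set_pmf C)"
  shows "N (measure_pmf.expectation C g) \<le> measure_pmf.expectation C (\<lambda>x. N (g x))"
proof -
  have "measure_pmf.expectation C g = (\<Sum>x\<in>set_pmf C. pmf C x *\<^sub>R g x)"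
    using assms(2) by (intro integral_measure_pmf) auto
  moreover have "measure_pmf.expectation C (\<lambda>x. N (g x)) = (\<Sum>x\<in>set_pmf C. pmf C x *\<^sub>R N (g x))"
    using assms(2) by (intro integral_measure_pmf) auto
  ultimately show ?thesis
    using is_norm_sum_le[OF assms(1), of "pmf C" g "set_pmf C"] by simp
qed

text \<open>Makes couplings of finitely supported distributions finitely supported, and lets bounds
  known only on the two supports hold almost everywhere under \<open>C\<close>.\<close>

lemma set_pmf_coupling_subset:
  assumes "C \<in> couplings P Q"
  shows "set_pmf C \<subseteq> set_pmf P \<times> set_pmf Q"
  using assms unfolding couplings_def by force

lemma coupling_expectation_diff:
  fixes f :: "'a \<Rightarrow> 'v::{banach, second_countable_topology}"
  assumes C: "C \<in> couplings P Q" and "finite (set_pmf P)" "finite (set_pmf Q)"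
  shows "measure_pmf.expectation P f - measure_pmf.expectation Q f
         = measure_pmf.expectation C (\<lambda>z. f (fst z) - f (snd z))"
proof -
  have fin: "finite (set_pmf C)"
    using set_pmf_coupling_subset[OF C] assms(2,3) by (meson finite_SigmaI finite_subset)
  have "P = map_pmf fst C" "Q = map_pmf snd C"
    using C unfolding couplings_def by auto
  then show ?thesis
    using fin by (simp add: integrable_measure_pmf_finite)
qed

text \<open>Needed because \<open>em_dist\<close> is an infimum in the reals, where a lower bound
  passes to the infimum only over a nonempty set.\<close>

lemma couplings_nonempty: "couplings P Q \<noteq> {}"
proof -
  have "pair_pmf P Q \<in> couplings P Q"
    unfolding couplings_def by (simp add: map_fst_pair_pmf map_snd_pair_pmf)
  then show ?thesis by blast
qed

lemma em_dist_nonneg: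
  assumes "\<And>x y. x \<in> set_pmf P \<Longrightarrow> y \<in> set_pmf Q \<Longrightarrow> 0 \<le> d x y"
  shows "0 \<le> em_dist d P Q"
  unfolding em_dist_def
proof (rule cINF_greatest[OF couplings_nonempty])
  fix C assume "C \<in> couplings P Q"
  then show "0 \<le> measure_pmf.expectation C (\<lambda>(x, x'). d x x')"
    using set_pmf_coupling_subset[of C P Q] assms
    by (intro integral_nonneg_AE) (auto simp: AE_measure_pmf_iff)
qed

lemma is_norm_expectation_diff_le_em_dist:
  fixes f :: "'a \<Rightarrow> 'v::{banach, second_countable_topology}"
  assumes N: "is_norm N" and fin: "finite (set_pmf P)" "finite (set_pmf Q)" and "0 \<le> l"
    and lip: "\<And>x y. x \<in> set_pmf P \<Longrightarrow> y \<in> set_pmf Q \<Longrightarrow> N (f x - f y) \<le> l * d x y"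
  shows "N (measure_pmf.expectation P f - measure_pmf.expectation Q f) \<le> l * em_dist d P Q"
    (is "?n \<le> _")
proof -
  have *: "?n \<le> l * measure_pmf.expectation C (\<lambda>(x, x'). d x x')" if C: "C \<in> couplings P Q" for C
  proof -
    note sub = set_pmf_coupling_subset[OF C]
    have finC: "finite (set_pmf C)"
      using sub fin by (meson finite_SigmaI finite_subset)
    have "?n \<le> measure_pmf.expectation C (\<lambda>z. N (f (fst z) - f (snd z)))"
      unfolding coupling_expectation_diff[OF C fin] by (rule is_norm_expectation_le[OF N finC])
    also have "\<dots> \<le> measure_pmf.expectation C (\<lambda>z. l * (case z of (x, x') \<Rightarrow> d x x'))"
      using sub finC lip
      by (intro integral_mono_AE integrable_measure_pmf_finite) (auto simp: AE_measure_pmf_iff)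
    finally show ?thesis by simp
  qed
  show ?thesis
  \<comment> \<open>For positive \<open>l\<close>, dividing by \<open>l\<close> gives a lower bound
    on every expectation, hence on their infimum. For \<open>l = 0\<close> a single coupling already
    gives \<open>?n \<le> 0\<close>.\<close>
  proof (cases "l = 0")
    case True
    then show ?thesis using * couplings_nonempty[of P Q] by auto
  next
    case False
    then have "0 < l" using \<open>0 \<le> l\<close> by simp
    have "?n / l \<le> em_dist d P Q"
      unfolding em_dist_def using * \<open>0 < l\<close>
      by (intro cINF_greatest[OF couplings_nonempty]) (simp add: pos_divide_le_eq mult.commute)
    then show ?thesis using \<open>0 < l\<close> by (simp add: pos_divide_le_eq mult.commute)
  qed
qed

theorem theorem4p1:
  fixes X :: "'a set" and d\<^sub>X :: "'a \<Rightarrow> 'a \<Rightarrow> real"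
    and N :: "real ^ 'd \<Rightarrow> real" and f :: "'a \<Rightarrow> real ^ 'd" and l :: real
  assumes "Metric_space X d\<^sub>X" and "finite X"
    and "\<And>x x'. x \<in> X \<Longrightarrow> x' \<in> X \<Longrightarrow> d\<^sub>X x x' \<le> 1"
    and "is_norm N"
    and "\<And>x x'. x \<in> X \<Longrightarrow> x' \<in> X \<Longrightarrow> N (f x - f x') \<le> l * d\<^sub>X x x'"
  shows "em_sensitivity X d\<^sub>X N (linear_query f) \<le> ereal l"
proof -
  interpret Metric_space X d\<^sub>X by fact
  have N0: "0 \<le> N v" for v using \<open>is_norm N\<close> unfolding is_norm_def by blast
  have "ereal (N (linear_query f K - linear_query f K'))
          / ereal (em_dist d\<^sub>X (pmf_of_multiset K) (pmf_of_multiset K')) \<le> ereal l"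
    if K: "K \<in> datasets X" "K' \<in> datasets X" and ne: "pmf_of_multiset K \<noteq> pmf_of_multiset K'"
    for K K'
  proof -
    let ?P = "pmf_of_multiset K" and ?Q = "pmf_of_multiset K'"
    let ?n = "N (linear_query f K - linear_query f K')" and ?e = "em_dist d\<^sub>X ?P ?Q"
    have sP: "set_pmf ?P \<subseteq> X" and sQ: "set_pmf ?Q \<subseteq> X"
      and fin: "finite (set_pmf ?P)" "finite (set_pmf ?Q)"
      using K unfolding datasets_def by auto
    \<comment> \<open>The sign of \<open>l\<close> must be derived: on a one-point space the
      Lipschitz condition allows negative \<open>l\<close>. Distinct empirical distributions require
      two distinct points, and the Lipschitz bound at these, whose distance is positive, forces
      \<open>0 \<le> l\<close>.\<close>
    have "\<exists>x\<in>X. \<exists>y\<in>X. x \<noteq> y"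
    proof (rule ccontr)
      assume "\<not> ?thesis"
      then obtain a where "X \<subseteq> {a}" by blast
      then have "?P = return_pmf a" "?Q = return_pmf a"
        using sP sQ by (meson order_trans set_pmf_subset_singleton)+
      then show False using ne by simp
    qed
    then obtain x y where xy: "x \<in> X" "y \<in> X" "x \<noteq> y" by blast
    then have "0 \<le> l * d\<^sub>X x y" "0 < d\<^sub>X x y"
      using N0[of "f x - f y"] assms(5)[of x y] mdist_pos_eq[of x y] by auto
    then have l0: "0 \<le> l" by (simp add: zero_le_mult_iff)
    have le: "?n \<le> l * ?e"
      unfolding linear_query_def using sP sQ assms(5)
      by (intro is_norm_expectation_diff_le_em_dist[OF \<open>is_norm N\<close> fin l0]) blast
    have e0: "0 \<le> ?e"
      by (rule em_dist_nonneg) simp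
    show ?thesis
    \<comment> \<open>By \<open>le\<close> the numerator vanishes whenever \<open>?e\<close> does,
      so the quotient cannot be \<infinity>.\<close>
    proof (cases "?e = 0")
      case True
      text \<open>In the extended reals \<open>0 / 0 = 0\<close>.\<close>
      then have "?n = 0" using le N0[of "linear_query f K - linear_query f K'"] by simp
      then show ?thesis using l0 True by simp
    next
      case False
      then show ?thesis using le e0 by (simp add: pos_divide_le_eq)
    qed
  qed
  then show ?thesis
    unfolding em_sensitivity_def by (auto intro!: SUP_least)
qed

end
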